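(* Let $\mathbf g=(g_1,\dots,g_m)\in M^1(\mathbb R^n)\otimes\mathbb C^m$ generate a multi-window Gabor frame over $\Lambda_D$, let $\alpha\in\mathbb C^m$ be such that $v_\alpha=\sum_{s=1}^m\overline{\alpha_s}\,\mathcal Z_Dg_s(0,0)\neq0$, and let $$B_0:\mathcal H_{\mathbf d}\to\ell^2(K_D),\qquad (B_0(c))_q=\frac1{\sqrt d\,\|v_\alpha\|}\langle c,\mathsf W_qv_\alpha\rangle .$$ Let $\mathcal B_0:=\operatorname{Ran}(B_0)\subseteq\ell^2(K_D)$. Then $\Pi_0:=B_0B_0^*$ is the orthogonal projection of $\ell^2(K_D)$ onto $\mathcal B_0$. Consequently, for every $b\in\ell^2(K_D)$, $\widehat b:=\Pi_0b$ is the unique solution of $$\widehat b=\operatorname*{argmin}_{a\in\mathcal B_0}\|b-a\|_{\ell^2(K_D)},$$ and the corresponding logical vector is $\widehat c:=B_0^*b$; in particular $\widehat b=B_0\widehat c$.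
   Context: Inner products are linear in the first variable. $D=\operatorname{diag}(d_1,\dots,d_n)$, positive integers $d_1\mid\cdots\mid d_n$, $d=\prod_jd_j$. $\Lambda_D=D^{1/2}\mathbb Z^n\times D^{1/2}\mathbb Z^n$, $\Lambda_D^\circ=D^{-1/2}\mathbb Z^n\times D^{-1/2}\mathbb Z^n$. For $z=(x,\omega)\in\mathbb R^{2n}$, $\rho(x,\omega)=e^{-\pi i x\cdot\omega}M_\omega T_x$ with $(T_xf)(t)=f(t-x)$, $(M_\omega f)(t)=e^{2\pi i\omega\cdot t}f(t)$. $M^1(\mathbb R^n)$ is the Feichtinger algebra: all $f$ with $z\mapsto\langle f,\rho(z)\varphi\rangle\in L^1(\mathbb R^{2n})$ for a fixed nonzero Schwartz $\varphi$. That $\mathbf g$ generates a multi-window Gabor frame over $\Lambda_D$ means $\{\rho(\lambda)g_j:\lambda\in\Lambda_D,1\le j\le m\}$ is a frame of $L^2(\mathbb R^n)$. $\mathbb Z_{\mathbf d}=\prod_j\mathbb Z_{d_j}$, $\mathcal H_{\mathbf d}=\bigotimes_j\mathbb C^{d_j}$ with orthonormal basis $(e_r)_{r\in\mathbb Z_{\mathbf d}}$, $\delta_r=D^{-1/2}r$. For $h\in M^1(\mathbb R^n)$, $Z_Dh(x,\omega)=\sum_{\gamma\in D^{1/2}\mathbb Z^n}h(x-\gamma)e^{2\pi i\gamma\cdot\omega}$ and $(\mathcal Z_Dh(x,\omega))_r=e^{-2\pi i\delta_r\cdot\omega}Z_Dh(x+\delta_r,\omega)$. $K_D=\Lambda_D^\circ/\Lambda_D\cong\mathbb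 Z_{\mathbf d}\times\mathbb Z_{\mathbf d}$; for $q=(r,s)$ with fixed integer representatives, $\mathsf W_q=e^{\pi i r^TD^{-1}s}X_1^{r_1}\cdots X_n^{r_n}Z_1^{s_1}\cdots Z_n^{s_n}$, where $X_ie_r=e_{r+\varepsilon_i}$ ($\varepsilon_i$ the $i$-th standard basis vector), $Z_ie_r=e^{2\pi i r_i/d_i}e_r$. *)

theory Defs
  imports "HOL-Analysis.Analysis"
begin

definition L2 :: "(real ^ 'n \<Rightarrow> complex) \<Rightarrow> bool" where
  "L2 f \<longleftrightarrow> f \<in> borel_measurable lborel \<and> integrable lborel (\<lambda>t. (cmod (f t))\<^sup>2)"

definition L2_inner :: "(real ^ 'n \<Rightarrow> complex) \<Rightarrow> (real ^ 'n \<Rightarrow> complex) \<Rightarrow> complex" where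
  "L2_inner f g = (LINT t|lborel. f t * cnj (g t))"

definition L2_norm :: "(real ^ 'n \<Rightarrow> complex) \<Rightarrow> real" where
  "L2_norm f = sqrt (LINT t|lborel. (cmod (f t))\<^sup>2)"

definition translation :: "real ^ 'n \<Rightarrow> (real ^ 'n \<Rightarrow> complex) \<Rightarrow> (real ^ 'n \<Rightarrow> complex)" where
  "translation x f = (\<lambda>t. f (t - x))"

definition modulation :: "real ^ 'n \<Rightarrow> (real ^ 'n \<Rightarrow> complex) \<Rightarrow> (real ^ 'n \<Rightarrow> complex)" where
  "modulation \<omega> f = (\<lambda>t. cis (2 * pi * (\<omega> \<bullet> t)) * f t)"

definition tf_shift ::
    "(real ^ 'n) \<times> (real ^ 'n) \<Rightarrow> (real ^ 'n \<Rightarrow> complex) \<Rightarrow> (real ^ 'n \<Rightarrow> complex)" where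
  "tf_shift = (\<lambda>(x, \<omega>) f t. cis (- (pi * (x \<bullet> \<omega>))) * modulation \<omega> (translation x f) t)"

definition partial_deriv :: "'n \<Rightarrow> (real ^ 'n \<Rightarrow> complex) \<Rightarrow> (real ^ 'n \<Rightarrow> complex)" where
  "partial_deriv i f = (\<lambda>x. frechet_derivative f (at x) (axis i 1))"

text \<open>Total differentiability of every iterated partial derivative is the same as smoothness.\<close>

definition schwartz :: "(real ^ 'n \<Rightarrow> complex) \<Rightarrow> bool" where
  "schwartz f \<longleftrightarrow> (\<forall>is. (\<forall>x. fold partial_deriv is f differentiable (at x)) \<and>
     (\<forall>N. \<exists>C. \<forall>x. (1 + norm x) ^ N * cmod (fold partial_deriv is f x) \<le> C))"

text \<open>The space \<open>M\<^sup>1\<close>, for a nonzero Schwartz window \<open>\<phi>\<close>; different windows give the same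
  space. Its elements, a priori classes modulo null sets, have a unique continuous
  representative, and the Zak transform below evaluates pointwise, so the members are taken to
  be the continuous representatives. Every tempered distribution in \<open>M\<^sup>1\<close> is square integrable.\<close>

definition feichtinger :: "(real ^ 'n \<Rightarrow> complex) \<Rightarrow> (real ^ 'n \<Rightarrow> complex) set" where
  "feichtinger \<phi> = {f. continuous_on UNIV f \<and> L2 f \<and>
     integrable lborel (\<lambda>z :: (real ^ 'n) \<times> (real ^ 'n). L2_inner f (tf_shift z \<phi>))}"

definition L2_frame :: "'i set \<Rightarrow> ('i \<Rightarrow> real ^ 'n \<Rightarrow> complex) \<Rightarrow> bool" where
  "L2_frame I e \<longleftrightarrow> (\<forall>i\<in>I. L2 (e i)) \<and>
     (\<exists>A>0. \<exists>B>0. \<forall>f. L2 f \<longrightarrow>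
        (\<lambda>i. (cmod (L2_inner f (e i)))\<^sup>2) summable_on I \<and>
        A * (L2_norm f)\<^sup>2 \<le> (\<Sum>\<^sub>\<infinity>i\<in>I. (cmod (L2_inner f (e i)))\<^sup>2) \<and>
        (\<Sum>\<^sub>\<infinity>i\<in>I. (cmod (L2_inner f (e i)))\<^sup>2) \<le> B * (L2_norm f)\<^sup>2)"

definition sqrt_diag :: "('n \<Rightarrow> nat) \<Rightarrow> int ^ 'n \<Rightarrow> real ^ 'n" where
  "sqrt_diag d k = (\<chi> i. sqrt (real (d i)) * real_of_int (k $ i))"

definition inv_sqrt_diag :: "('n \<Rightarrow> nat) \<Rightarrow> int ^ 'n \<Rightarrow> real ^ 'n" where
  "inv_sqrt_diag d k = (\<chi> i. real_of_int (k $ i) / sqrt (real (d i)))"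

definition Lambda :: "('n \<Rightarrow> nat) \<Rightarrow> ((real ^ 'n) \<times> (real ^ 'n)) set" where
  "Lambda d = range (sqrt_diag d) \<times> range (sqrt_diag d)"

definition Lambda_adj :: "('n \<Rightarrow> nat) \<Rightarrow> ((real ^ 'n) \<times> (real ^ 'n)) set" where
  "Lambda_adj d = range (inv_sqrt_diag d) \<times> range (inv_sqrt_diag d)"

definition generates_gabor_frame ::
    "('n \<Rightarrow> nat) \<Rightarrow> ('m::finite \<Rightarrow> real ^ 'n \<Rightarrow> complex) \<Rightarrow> bool" where
  "generates_gabor_frame d g \<longleftrightarrow>
     L2_frame (Lambda d \<times> (UNIV :: 'm set)) (\<lambda>(z, j). tf_shift z (g j))"

text \<open>Elements of \<open>\<int>\<^sub>d\<close> are represented by their least nonnegative residues.\<close>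

definition Zd :: "('n \<Rightarrow> nat) \<Rightarrow> (int ^ 'n) set" where
  "Zd d = {r. \<forall>i. 0 \<le> r $ i \<and> r $ i < int (d i)}"

definition residue_vec :: "('n \<Rightarrow> nat) \<Rightarrow> int ^ 'n \<Rightarrow> int ^ 'n" where
  "residue_vec d r = (\<chi> i. (r $ i) mod int (d i))"

definition zak :: "('n \<Rightarrow> nat) \<Rightarrow> (real ^ 'n \<Rightarrow> complex) \<Rightarrow> real ^ 'n \<Rightarrow> real ^ 'n \<Rightarrow> complex" where
  "zak d h x \<omega> = (\<Sum>\<^sub>\<infinity>\<gamma>\<in>range (sqrt_diag d). h (x - \<gamma>) * cis (2 * pi * (\<gamma> \<bullet> \<omega>)))"

definition vector_zak ::
    "('n \<Rightarrow> nat) \<Rightarrow> (real ^ 'n \<Rightarrow> complex) \<Rightarrow> real ^ 'n \<Rightarrow> real ^ 'n \<Rightarrow> (int ^ 'n \<Rightarrow> complex)" where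
  "vector_zak d h x \<omega> = (\<lambda>r. if r \<in> Zd d
     then cis (- (2 * pi * (inv_sqrt_diag d r \<bullet> \<omega>))) * zak d h (x + inv_sqrt_diag d r) \<omega>
     else 0)"

text \<open>For a finite set \<open>S\<close>, \<open>\<ell>\<^sup>2(S)\<close> is the set of functions extended by zero outside \<open>S\<close>.
  The space \<open>\<H>\<^sub>d\<close> is \<open>l2 (Zd d)\<close>, the elementary tensor \<open>e\<^sub>r\<close> being \<open>basis_vec r\<close>.\<close>

definition l2 :: "'s set \<Rightarrow> ('s \<Rightarrow> complex) set" where
  "l2 S = {a. \<forall>s. s \<notin> S \<longrightarrow> a s = 0}"

definition l2_inner :: "'s set \<Rightarrow> ('s \<Rightarrow> complex) \<Rightarrow> ('s \<Rightarrow> complex) \<Rightarrow> complex" where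
  "l2_inner S a b = (\<Sum>s\<in>S. a s * cnj (b s))"

definition l2_norm :: "'s set \<Rightarrow> ('s \<Rightarrow> complex) \<Rightarrow> real" where
  "l2_norm S a = sqrt (\<Sum>s\<in>S. (cmod (a s))\<^sup>2)"

definition basis_vec :: "'s \<Rightarrow> 's \<Rightarrow> complex" where
  "basis_vec s = (\<lambda>t. if t = s then 1 else 0)"

text \<open>Meant for finite \<open>S\<close> and linear \<open>F\<close> from \<open>l2 S\<close> to \<open>l2 T\<close>; then the described vector
  exists and is unique.\<close>

definition l2_adjoint ::
    "'s set \<Rightarrow> 't set \<Rightarrow> (('s \<Rightarrow> complex) \<Rightarrow> ('t \<Rightarrow> complex)) \<Rightarrow> ('t \<Rightarrow> complex) \<Rightarrow> ('s \<Rightarrow> complex)" where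
  "l2_adjoint S T F b =
     (THE c. c \<in> l2 S \<and> (\<forall>a\<in>l2 S. l2_inner T (F a) b = l2_inner S a c))"

definition orthogonal_projection_onto ::
    "'s set \<Rightarrow> (('s \<Rightarrow> complex) \<Rightarrow> ('s \<Rightarrow> complex)) \<Rightarrow> ('s \<Rightarrow> complex) set \<Rightarrow> bool" where
  "orthogonal_projection_onto S P M \<longleftrightarrow>
     (\<forall>a\<in>l2 S. \<forall>b\<in>l2 S. \<forall>x y. P (\<lambda>s. x * a s + y * b s) = (\<lambda>s. x * P a s + y * P b s)) \<and>
     P ` l2 S = M \<and> M \<subseteq> l2 S \<and>
     (\<forall>a\<in>l2 S. P (P a) = P a) \<and>
     (\<forall>a\<in>l2 S. \<forall>b\<in>l2 S. l2_inner S (P a) b = l2_inner S a (P b))"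

definition X_op :: "('n \<Rightarrow> nat) \<Rightarrow> 'n \<Rightarrow> (int ^ 'n \<Rightarrow> complex) \<Rightarrow> (int ^ 'n \<Rightarrow> complex)" where
  "X_op d i c = (\<lambda>t. \<Sum>r\<in>Zd d. c r * basis_vec (residue_vec d (r + axis i 1)) t)"

definition Z_op :: "('n \<Rightarrow> nat) \<Rightarrow> 'n \<Rightarrow> (int ^ 'n \<Rightarrow> complex) \<Rightarrow> (int ^ 'n \<Rightarrow> complex)" where
  "Z_op d i c = (\<lambda>t. \<Sum>r\<in>Zd d. c r * (cis (2 * pi * real_of_int (r $ i) / real (d i)) * basis_vec r t))"

text \<open>Integer powers of an operator that is invertible on \<open>V\<close>.\<close>

definition op_powi :: "'a set \<Rightarrow> ('a \<Rightarrow> 'a) \<Rightarrow> int \<Rightarrow> 'a \<Rightarrow> 'a" where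
  "op_powi V F k = (if 0 \<le> k then F ^^ nat k else inv_into V F ^^ nat (- k))"

definition ordered_op_prod :: "('n::{finite,linorder} \<Rightarrow> 'a \<Rightarrow> 'a) \<Rightarrow> 'a \<Rightarrow> 'a" where
  "ordered_op_prod F = foldr (\<lambda>i G. F i \<circ> G) (sorted_list_of_set UNIV) id"

definition weyl_op :: "('n::{finite,linorder} \<Rightarrow> nat) \<Rightarrow> (int ^ ('n::{finite,linorder})) \<times> (int ^ ('n::{finite,linorder})) \<Rightarrow>
    (int ^ ('n::{finite,linorder}) \<Rightarrow> complex) \<Rightarrow> (int ^ ('n::{finite,linorder}) \<Rightarrow> complex)" where
  "weyl_op d = (\<lambda>(r, s) c t.
     cis (pi * (\<Sum>i\<in>UNIV. real_of_int (r $ i) * real_of_int (s $ i) / real (d i))) *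
     ordered_op_prod (\<lambda>i. op_powi (l2 (Zd d)) (X_op d i) (r $ i))
       (ordered_op_prod (\<lambda>i. op_powi (l2 (Zd d)) (Z_op d i) (s $ i)) c) t)"

definition KD :: "('n \<Rightarrow> nat) \<Rightarrow> ((real ^ 'n) \<times> (real ^ 'n)) set set" where
  "KD d = Lambda_adj d // {(z, w). z \<in> Lambda_adj d \<and> w \<in> Lambda_adj d \<and> z - w \<in> Lambda d}"

text \<open>A choice of integer representatives \<open>(r, s)\<close> of the cosets \<open>q\<close>. The Weyl operators depend on
  this choice, but only up to a sign.\<close>

definition integer_reps :: "('n \<Rightarrow> nat) \<Rightarrow>
    (((real ^ 'n) \<times> (real ^ 'n)) set \<Rightarrow> (int ^ 'n) \<times> (int ^ 'n)) \<Rightarrow> bool" where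
  "integer_reps d rep \<longleftrightarrow>
     (\<forall>q\<in>KD d. (inv_sqrt_diag d (fst (rep q)), inv_sqrt_diag d (snd (rep q))) \<in> q)"

definition v_alpha :: "('n \<Rightarrow> nat) \<Rightarrow> ('m::finite \<Rightarrow> real ^ 'n \<Rightarrow> complex) \<Rightarrow> complex ^ 'm \<Rightarrow>
    (int ^ 'n \<Rightarrow> complex)" where
  "v_alpha d g \<alpha> = (\<lambda>r. \<Sum>s\<in>UNIV. cnj (\<alpha> $ s) * vector_zak d (g s) 0 0 r)"

definition B0 :: "('n::{finite,linorder} \<Rightarrow> nat) \<Rightarrow>
    (((real ^ ('n::{finite,linorder})) \<times> (real ^ ('n::{finite,linorder}))) set \<Rightarrow> (int ^ ('n::{finite,linorder})) \<times> (int ^ ('n::{finite,linorder}))) \<Rightarrow>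
    (int ^ ('n::{finite,linorder}) \<Rightarrow> complex) \<Rightarrow> (int ^ ('n::{finite,linorder}) \<Rightarrow> complex) \<Rightarrow>
    (((real ^ ('n::{finite,linorder})) \<times> (real ^ ('n::{finite,linorder}))) set \<Rightarrow> complex)" where
  "B0 d rep v c = (\<lambda>q. if q \<in> KD d
     then complex_of_real (1 / (sqrt (real (\<Prod>i\<in>UNIV. d i)) * l2_norm (Zd d) v)) *
          l2_inner (Zd d) c (weyl_op d (rep q) v)
     else 0)"

end

theory Submission
  imports Defs
begin

text \<open>The claim reduces to \<open>B\<^sub>0\<close> being an isometry. Up to a phase, \<open>W\<^sub>q v\<close> with \<open>q = (r, s)\<close> is the translate of \<open>v\<close> by \<open>r\<close>
  times the character of index \<open>s\<close>, so summing \<open>\<bar>\<langle>c, W\<^sub>q v\<rangle>\<bar>\<^sup>2\<close> first over \<open>s\<close> (Parseval for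
  \<open>\<int>\<^sub>d\<close>) and then over \<open>r\<close> yields \<open>(\<Prod>\<^sub>j d\<^sub>j) \<parallel>c\<parallel>\<^sup>2 \<parallel>v\<parallel>\<^sup>2\<close>. Changing the representative
  \<open>(r, s)\<close> modulo \<open>d\<close> only changes the phase.\<close>

section \<open>Finite-dimensional Hilbert space\<close>

lemma l2_inner_self: "l2_inner S a a = of_real ((l2_norm S a)\<^sup>2)"
proof -
  have "0 \<le> (\<Sum>s\<in>S. (cmod (a s))\<^sup>2)" by (rule sum_nonneg) simp
  thus ?thesis
    by (simp add: l2_inner_def l2_norm_def complex_norm_square[symmetric] del: of_real_power)
qed

lemma l2_inner_commute: "l2_inner S a b = cnj (l2_inner S b a)"
  by (simp add: l2_inner_def mult.commute)

lemma l2_inner_lin_left: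
  "l2_inner S (\<lambda>s. x * a s + y * b s) c = x * l2_inner S a c + y * l2_inner S b c"
  by (simp add: l2_inner_def sum_distrib_left sum.distrib algebra_simps)

lemma l2_inner_diff_left: "l2_inner S (\<lambda>s. a s - b s) c = l2_inner S a c - l2_inner S b c"
  using l2_inner_lin_left[of S 1 a "-1" b c] by simp

lemma l2_inner_diff_right: "l2_inner S c (\<lambda>s. a s - b s) = l2_inner S c a - l2_inner S c b"
  by (metis l2_inner_commute l2_inner_diff_left complex_cnj_diff)

lemma l2_norm_eq_0_iff:
  assumes "finite S" "a \<in> l2 S"
  shows "l2_norm S a = 0 \<longleftrightarrow> a = (\<lambda>s. 0)"
proof
  assume "l2_norm S a = 0"
  hence "(\<Sum>s\<in>S. (cmod (a s))\<^sup>2) = 0" by (simp add: l2_norm_def)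
  hence "\<forall>s\<in>S. (cmod (a s))\<^sup>2 = 0"
    using assms(1) by (subst (asm) sum_nonneg_eq_0_iff) auto
  thus "a = (\<lambda>s. 0)" using assms(2) by (auto simp: l2_def)
qed (simp add: l2_norm_def)

lemma l2_norm_nonneg: "0 \<le> l2_norm S a"
  by (simp add: l2_norm_def sum_nonneg)

lemma l2_diff: "a \<in> l2 S \<Longrightarrow> b \<in> l2 S \<Longrightarrow> (\<lambda>s. a s - b s) \<in> l2 S"
  by (simp add: l2_def)

text \<open>Nondegeneracy: the hypothesis is applied to \<open>c\<close> = \<open>a - b\<close>,
  whose norm then vanishes.\<close>

lemma l2_eqI:
  assumes "finite S" "a \<in> l2 S" "b \<in> l2 S"
    and "\<And>c. c \<in> l2 S \<Longrightarrow> l2_inner S c a = l2_inner S c b"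
  shows "a = b"
proof -
  let ?u = "\<lambda>s. a s - b s"
  have u: "?u \<in> l2 S" using assms(2,3) by (rule l2_diff)
  have "l2_inner S ?u ?u = 0" using assms(4)[OF u] by (simp add: l2_inner_diff_right)
  hence "l2_norm S ?u = 0" by (simp add: l2_inner_self)
  hence "?u = (\<lambda>s. 0)" using l2_norm_eq_0_iff[OF assms(1) u] by simp
  thus ?thesis by (simp add: fun_eq_iff)
qed

lemma l2_norm_pythagoras:
  assumes "l2_inner S a b = 0"
  shows "(l2_norm S (\<lambda>s. a s + b s))\<^sup>2 = (l2_norm S a)\<^sup>2 + (l2_norm S b)\<^sup>2"
proof -
  have "l2_inner S b a = 0" using assms l2_inner_commute[of S b a] by simp
  hence "l2_inner S (\<lambda>s. a s + b s) (\<lambda>s. a s + b s) = l2_inner S a a + l2_inner S b b"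
    using assms by (simp add: l2_inner_def sum.distrib algebra_simps)
  thus ?thesis by (simp only: l2_inner_self of_real_add[symmetric] of_real_eq_iff)
qed

text \<open>Turns the definite description behind \<open>l2_adjoint\<close> into a criterion: any
  vector satisfying the adjoint identity is the adjoint, since nondegeneracy leaves no second
  one.\<close>

lemma l2_adjoint_eqI:
  assumes "finite S" "c \<in> l2 S" "\<And>a. a \<in> l2 S \<Longrightarrow> l2_inner T (F a) b = l2_inner S a c"
  shows "l2_adjoint S T F b = c"
  unfolding l2_adjoint_def
proof (rule the_equality)
  fix c' assume "c' \<in> l2 S \<and> (\<forall>a\<in>l2 S. l2_inner T (F a) b = l2_inner S a c')"
  thus "c' = c" using assms by (intro l2_eqI[of S]) auto
qed (use assms in auto)

section \<open>Analysis and synthesis operators of a finite family of vectors\<close>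

definition analysis_op :: "'s set \<Rightarrow> 't set \<Rightarrow> ('t \<Rightarrow> 's \<Rightarrow> complex) \<Rightarrow> ('s \<Rightarrow> complex) \<Rightarrow> 't \<Rightarrow> complex" where
  "analysis_op S T w c = (\<lambda>q. if q \<in> T then l2_inner S c (w q) else 0)"

text \<open>The vectors \<open>w q\<close> may be nonzero outside \<open>S\<close>; the cut-off
  forces the values into \<open>l2 S\<close>, as the adjoint of \<open>analysis_op\<close>
  requires.\<close>

definition synthesis_op :: "'s set \<Rightarrow> 't set \<Rightarrow> ('t \<Rightarrow> 's \<Rightarrow> complex) \<Rightarrow> ('t \<Rightarrow> complex) \<Rightarrow> 's \<Rightarrow> complex" where
  "synthesis_op S T w b = (\<lambda>s. if s \<in> S then \<Sum>q\<in>T. b q * w q s else 0)"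

lemma analysis_op_in_l2: "analysis_op S T w c \<in> l2 T"
  by (simp add: analysis_op_def l2_def)

lemma synthesis_op_in_l2: "synthesis_op S T w b \<in> l2 S"
  by (simp add: synthesis_op_def l2_def)

lemma analysis_op_lin:
  "analysis_op S T w (\<lambda>s. x * a s + y * b s) = (\<lambda>q. x * analysis_op S T w a q + y * analysis_op S T w b q)"
  by (auto simp: analysis_op_def l2_inner_lin_left)

lemma synthesis_op_lin:
  "synthesis_op S T w (\<lambda>s. x * a s + y * b s) = (\<lambda>q. x * synthesis_op S T w a q + y * synthesis_op S T w b q)"
  by (auto simp: synthesis_op_def sum_distrib_left sum.distrib algebra_simps)

lemma analysis_synthesis_adjoint:
  "l2_inner T (analysis_op S T w a) b = l2_inner S a (synthesis_op S T w b)"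
proof -
  have "l2_inner T (analysis_op S T w a) b = (\<Sum>q\<in>T. \<Sum>s\<in>S. a s * cnj (w q s) * cnj (b q))"
    by (simp add: l2_inner_def analysis_op_def sum_distrib_right)
  also have "\<dots> = (\<Sum>s\<in>S. \<Sum>q\<in>T. a s * cnj (w q s) * cnj (b q))" by (rule sum.swap)
  also have "\<dots> = l2_inner S a (synthesis_op S T w b)"
    by (simp add: l2_inner_def synthesis_op_def sum_distrib_left mult_ac)
  finally show ?thesis .
qed

lemma l2_adjoint_analysis_op:
  assumes "finite S"
  shows "l2_adjoint S T (analysis_op S T w) = synthesis_op S T w"
  by (rule ext, rule l2_adjoint_eqI[OF assms synthesis_op_in_l2 analysis_synthesis_adjoint])

text \<open>The abstract core of the proposition. An isometry satisfies \<open>B' (B c) = c\<close>,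
  which makes \<open>B \<circ> B'\<close> idempotent, and the adjoint relation makes it
  self-adjoint. The residual \<open>b - B (B' b)\<close> is orthogonal to the range of
  \<open>B\<close>, so Pythagoras settles the minimisation.\<close>

lemma isometric_analysis_op_projection:
  fixes S :: "'s set" and T :: "'t set" and w :: "'t \<Rightarrow> 's \<Rightarrow> complex"
  defines "B \<equiv> analysis_op S T w"
  defines "B' \<equiv> synthesis_op S T w"
  assumes fin: "finite S" "finite T"
    and iso: "\<And>a c. l2_inner T (B a) (B c) = l2_inner S a c"
  shows "c \<in> l2 S \<Longrightarrow> B' (B c) = c"
    and "orthogonal_projection_onto T (B \<circ> B') (B ` l2 S)"
    and "b \<in> l2 T \<Longrightarrow>
      is_arg_min (\<lambda>a. l2_norm T (\<lambda>q. b q - a q)) (\<lambda>a. a \<in> B ` l2 S) a \<longleftrightarrow> a = B (B' b)"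
proof -
  have adj: "l2_inner T (B a) b = l2_inner S a (B' b)" for a b
    unfolding B_def B'_def by (rule analysis_synthesis_adjoint)
  have adj': "l2_inner T b (B a) = l2_inner S (B' b) a" for a b
    by (metis adj l2_inner_commute)
  have BT: "B a \<in> l2 T" for a unfolding B_def by (rule analysis_op_in_l2)
  have B'S: "B' a \<in> l2 S" for a unfolding B'_def by (rule synthesis_op_in_l2)
  show left_inv: "B' (B c) = c" if "c \<in> l2 S" for c
    using that by (intro l2_eqI[OF fin(1) B'S]) (auto simp: adj[symmetric] iso)
  \<comment> \<open>Having a right inverse, \<open>B'\<close> is onto, so composing with it loses
    nothing of the range of \<open>B\<close>.\<close>
  have "B' ` l2 T = l2 S"
  proof
    show "l2 S \<subseteq> B' ` l2 T" using left_inv BT by (metis imageI subsetI)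
  qed (use B'S in blast)
  hence "(B \<circ> B') ` l2 T = B ` l2 S" by (simp only: image_comp[symmetric])
  thus "orthogonal_projection_onto T (B \<circ> B') (B ` l2 S)"
    unfolding orthogonal_projection_onto_def
    \<comment> \<open>Linearity is read off the unfolded operators; the remaining conditions are
      proved after folding back, where the left inverse and the adjoint relations apply.\<close>
    by (auto simp: B_def B'_def analysis_op_lin synthesis_op_lin)
       (auto simp: B_def[symmetric] B'_def[symmetric] BT left_inv[OF B'S] adj adj')
  assume b: "b \<in> l2 T"
  let ?p = "B (B' b)"
  have split: "(l2_norm T (\<lambda>q. b q - a q))\<^sup>2
      = (l2_norm T (\<lambda>q. b q - ?p q))\<^sup>2 + (l2_norm T (\<lambda>q. ?p q - a q))\<^sup>2" if a_in: "a \<in> B ` l2 S" for a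
  proof -
    obtain c where a: "a = B c" using a_in by blast
    have "l2_inner T (\<lambda>q. b q - ?p q) (\<lambda>q. ?p q - a q) = 0"
      unfolding a by (simp add: l2_inner_diff_left l2_inner_diff_right iso adj' left_inv B'S)
    from l2_norm_pythagoras[OF this] show ?thesis by simp
  qed
  have p: "?p \<in> B ` l2 S" using B'S by blast
  have min: "l2_norm T (\<lambda>q. b q - ?p q) \<le> l2_norm T (\<lambda>q. b q - a q)" if "a \<in> B ` l2 S" for a
    by (rule power2_le_imp_le) (simp_all add: split[OF that] l2_norm_nonneg)
  \<comment> \<open>A competitor at least as good attains equality in the Pythagorean split, so its
    distance to \<open>?p\<close> is zero.\<close>
  have "a = ?p" if a: "a \<in> B ` l2 S" "l2_norm T (\<lambda>q. b q - a q) \<le> l2_norm T (\<lambda>q. b q - ?p q)" for a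
  proof -
    have "l2_norm T (\<lambda>q. b q - a q) = l2_norm T (\<lambda>q. b q - ?p q)"
      using min[OF a(1)] a(2) by simp
    hence "l2_norm T (\<lambda>q. ?p q - a q) = 0" using split[OF a(1)] by simp
    moreover have "(\<lambda>q. ?p q - a q) \<in> l2 T" using a BT by (intro l2_diff) auto
    ultimately have "(\<lambda>q. ?p q - a q) = (\<lambda>q. 0)" using l2_norm_eq_0_iff[OF fin(2)] by blast
    thus ?thesis by (simp add: fun_eq_iff)
  qed
  thus "is_arg_min (\<lambda>a. l2_norm T (\<lambda>q. b q - a q)) (\<lambda>a. a \<in> B ` l2 S) a \<longleftrightarrow> a = ?p"
    using p min unfolding is_arg_min_def by (metis linorder_not_less)
qed

section \<open>Characters of the index group\<close>

lemma residue_vec_in_Zd: "\<forall>i. 0 < d i \<Longrightarrow> residue_vec d r \<in> Zd d"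
  by (simp add: Zd_def residue_vec_def)

lemma residue_vec_id: "r \<in> Zd d \<Longrightarrow> residue_vec d r = r"
  by (simp add: Zd_def residue_vec_def vec_eq_iff)

lemma residue_vec_eq_iff: "residue_vec d r = residue_vec d s \<longleftrightarrow> (\<forall>i. int (d i) dvd r $ i - s $ i)"
  by (simp add: residue_vec_def vec_eq_iff mod_eq_dvd_iff)

lemma residue_vec_diff_left: "residue_vec d (residue_vec d r - s) = residue_vec d (r - s)"
  by (simp add: residue_vec_def vec_eq_iff mod_diff_left_eq)

lemma residue_vec_diff_right: "residue_vec d (r - residue_vec d s) = residue_vec d (r - s)"
  by (simp add: residue_vec_def vec_eq_iff mod_diff_right_eq)

lemma residue_vec_add_left: "residue_vec d (residue_vec d r + s) = residue_vec d (r + s)"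
  by (simp add: residue_vec_def vec_eq_iff mod_add_left_eq)

text \<open>Identifies the index group with a box of integer intervals, whose finiteness and size
  are known.\<close>

lemma Zd_bij_PiE:
  "bij_betw (\<lambda>r i. r $ i) (Zd d) (PiE UNIV (\<lambda>i. {0..<int (d i)}))"
  by (rule bij_betw_byWitness[where f' = vec_lambda]) (auto simp: Zd_def)

lemma finite_Zd: "finite (Zd (d :: 'n::finite \<Rightarrow> nat))"
  using bij_betw_finite[OF Zd_bij_PiE[of d]] by (simp add: finite_PiE)

lemma card_Zd: "card (Zd (d :: 'n::finite \<Rightarrow> nat)) = (\<Prod>i\<in>UNIV. d i)"
  using bij_betw_same_card[OF Zd_bij_PiE[of d]] by (simp add: card_PiE)

lemma bij_betw_Zd_translate:
  assumes "\<forall>i. 0 < d i"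
  shows "bij_betw (\<lambda>s. residue_vec d (s + a)) (Zd d) (Zd d)"
  using residue_vec_in_Zd[OF assms]
  by (intro bij_betw_byWitness[where f' = "\<lambda>s. residue_vec d (s - a)"])
     (auto simp: residue_vec_diff_left residue_vec_add_left residue_vec_id)

text \<open>Reflection is its own inverse modulo \<open>d\<close>. It later turns a sum over shifts
  \<open>r\<close> at a fixed \<open>t\<close> into a sum over all entries of
  \<open>v\<close>.\<close>

lemma bij_betw_Zd_reflect:
  assumes "\<forall>i. 0 < d i"
  shows "bij_betw (\<lambda>s. residue_vec d (a - s)) (Zd d) (Zd d)"
  using residue_vec_in_Zd[OF assms]
  by (intro bij_betw_byWitness[where f' = "\<lambda>s. residue_vec d (a - s)"])
     (auto simp: residue_vec_diff_right residue_vec_id)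

section \<open>Characters, their orthogonality and Parseval's identity\<close>

definition Zd_char :: "('n::finite \<Rightarrow> nat) \<Rightarrow> int ^ 'n \<Rightarrow> int ^ 'n \<Rightarrow> complex" where
  "Zd_char d s t = cis (2 * pi * (\<Sum>i\<in>UNIV. real_of_int (s $ i) * real_of_int (t $ i) / real (d i)))"

lemma Zd_char_commute: "Zd_char d s t = Zd_char d t s"
  by (simp add: Zd_char_def mult.commute)

lemma Zd_char_add_left: "Zd_char d (r + s) t = Zd_char d r t * Zd_char d s t"
  by (simp add: Zd_char_def cis_mult sum.distrib[symmetric] algebra_simps add_divide_distrib flip: distrib_left)

lemma Zd_char_add_right: "Zd_char d s (t + u) = Zd_char d s t * Zd_char d s u"
  by (metis Zd_char_commute Zd_char_add_left)

lemma cmod_Zd_char: "cmod (Zd_char d s t) = 1"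
  by (simp add: Zd_char_def)

lemma Zd_char_mult_cnj: "Zd_char d s t * cnj (Zd_char d s t) = 1"
  by (simp add: complex_norm_square[symmetric] cmod_Zd_char)

lemma Zd_char_zero: "Zd_char d 0 t = 1"
  by (simp add: Zd_char_def)

lemma Zd_char_diff_right: "Zd_char d s (t - u) = Zd_char d s t * cnj (Zd_char d s u)"
proof -
  have "Zd_char d s t = Zd_char d s (t - u) * Zd_char d s u"
    using Zd_char_add_right[of d s "t - u" u] by simp
  thus ?thesis by (simp add: mult.assoc Zd_char_mult_cnj)
qed

text \<open>Each summand of the exponent is an integer, because the factor \<open>s $ i\<close>
  absorbs the denominator \<open>d i\<close>.\<close>

lemma Zd_char_eq_1:
  assumes "\<forall>i. 0 < d i" "\<And>i. int (d i) dvd s $ i"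
  shows "Zd_char d s t = 1"
proof -
  have "(\<Sum>i\<in>UNIV. real_of_int (s $ i) * real_of_int (t $ i) / real (d i)) \<in> \<int>"
  proof (rule Ints_sum)
    fix i
    obtain k where "s $ i = int (d i) * k" using assms(2) by (auto elim: dvdE)
    hence "real_of_int (s $ i) * real_of_int (t $ i) / real (d i) = real_of_int (k * t $ i)"
      using assms(1)[rule_format, of i] by simp
    thus "real_of_int (s $ i) * real_of_int (t $ i) / real (d i) \<in> \<int>" by (simp only: Ints_of_int)
  qed
  thus ?thesis by (simp add: Zd_char_def cis_multiple_2pi)
qed

text \<open>\<open>Zd_char\<close> is defined on all integer vectors so that additivity holds
  without reduction; this is its periodicity, that is, its descent to the index group.\<close>

lemma Zd_char_residue_left:
  assumes "\<forall>i. 0 < d i"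
  shows "Zd_char d (residue_vec d s) t = Zd_char d s t"
proof -
  have "Zd_char d (s - residue_vec d s) t = 1"
    by (rule Zd_char_eq_1[OF assms]) (simp add: residue_vec_def)
  moreover have "Zd_char d s t = Zd_char d (s - residue_vec d s) t * Zd_char d (residue_vec d s) t"
    by (simp flip: Zd_char_add_left)
  ultimately show ?thesis by simp
qed

lemma Zd_char_residue_right:
  assumes "\<forall>i. 0 < d i"
  shows "Zd_char d s (residue_vec d t) = Zd_char d s t"
  by (metis Zd_char_commute Zd_char_residue_left[OF assms])

text \<open>Translating \<open>s\<close> by the \<open>j\<close>-th unit vector permutes the terms
  and multiplies the sum by a factor different from 1, so the sum is zero.\<close>

lemma sum_Zd_char_eq_0:
  assumes d: "\<forall>i. 0 < d i" and t: "\<not> int (d j) dvd t $ j"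
  shows "(\<Sum>s\<in>Zd d. Zd_char d s t) = 0"
proof -
  have ax: "Zd_char d (axis j 1) t = cis (2 * pi * (real_of_int (t $ j) / real (d j)))"
  proof -
    have "(\<Sum>i\<in>UNIV. real_of_int (axis j 1 $ i) * real_of_int (t $ i) / real (d i))
        = (\<Sum>i\<in>UNIV. if i = j then real_of_int (t $ j) / real (d j) else 0)"
      by (rule sum.cong) (auto simp: axis_def)
    thus ?thesis by (simp add: Zd_char_def)
  qed
  \<comment> \<open>Equality would give a cosine equal to 1, hence an integer quotient of
    \<open>t $ j\<close> by \<open>d j\<close>.\<close>
  have "Zd_char d (axis j 1) t \<noteq> 1"
  proof
    assume "Zd_char d (axis j 1) t = 1"
    hence "cos (2 * pi * (real_of_int (t $ j) / real (d j))) = 1"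
      by (metis ax cis.simps(1) one_complex.simps(1))
    then obtain k where "2 * pi * (real_of_int (t $ j) / real (d j)) = of_int k * 2 * pi"
      by (auto simp: cos_one_2pi_int)
    hence "real_of_int (t $ j) = real_of_int (int (d j) * k)"
      using d[rule_format, of j] by (simp add: field_simps)
    hence "t $ j = int (d j) * k" by (simp only: of_int_eq_iff)
    thus False using t by simp
  qed
  moreover have "(\<Sum>s\<in>Zd d. Zd_char d s t) * Zd_char d (axis j 1) t
      = (\<Sum>s\<in>Zd d. Zd_char d (residue_vec d (s + axis j 1)) t)"
    by (simp add: Zd_char_residue_left[OF d] Zd_char_add_left sum_distrib_right)
  hence "(\<Sum>s\<in>Zd d. Zd_char d s t) * Zd_char d (axis j 1) t = (\<Sum>s\<in>Zd d. Zd_char d s t)"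
    by (simp only: sum.reindex_bij_betw[OF bij_betw_Zd_translate[OF d], of "\<lambda>s. Zd_char d s t"])
  ultimately show ?thesis by simp
qed

text \<open>The product is the character value at \<open>u - t\<close>; distinct reduced vectors
  differ modulo \<open>d j\<close> in some coordinate \<open>j\<close>, which is what the vanishing
  sum asks for.\<close>

lemma Zd_char_orthogonal:
  assumes d: "\<forall>i. 0 < d i" and tu: "t \<in> Zd d" "u \<in> Zd d"
  shows "(\<Sum>s\<in>Zd d. Zd_char d s u * cnj (Zd_char d s t)) = (if t = u then of_nat (card (Zd d)) else 0)"
proof (cases "t = u")
  case True
  thus ?thesis by (simp add: Zd_char_mult_cnj)
next
  case False
  hence "residue_vec d u \<noteq> residue_vec d t" using tu by (simp add: residue_vec_id)
  then obtain j where "\<not> int (d j) dvd (u - t) $ j" by (auto simp: residue_vec_eq_iff)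
  from sum_Zd_char_eq_0[OF d this] show ?thesis using False by (simp add: Zd_char_diff_right)
qed

text \<open>The characters are left unnormalised, hence the factor \<open>card (Zd d)\<close>. The
  sum over \<open>s\<close> is moved innermost, where orthogonality keeps only the diagonal
  \<open>t = u\<close>.\<close>

lemma Zd_parseval:
  assumes d: "\<forall>i. 0 < d i"
  shows "(\<Sum>s\<in>Zd d. l2_inner (Zd d) f (Zd_char d s) * cnj (l2_inner (Zd d) h (Zd_char d s)))
    = of_nat (card (Zd d)) * l2_inner (Zd d) f h"
proof -
  have "(\<Sum>s\<in>Zd d. l2_inner (Zd d) f (Zd_char d s) * cnj (l2_inner (Zd d) h (Zd_char d s)))
    = (\<Sum>s\<in>Zd d. \<Sum>t\<in>Zd d. \<Sum>u\<in>Zd d. f t * cnj (h u) * (Zd_char d s u * cnj (Zd_char d s t)))"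
    by (simp add: l2_inner_def sum_product mult_ac)
  also have "\<dots> = (\<Sum>t\<in>Zd d. \<Sum>s\<in>Zd d. \<Sum>u\<in>Zd d. f t * cnj (h u) * (Zd_char d s u * cnj (Zd_char d s t)))"
    by (rule sum.swap)
  also have "\<dots> = (\<Sum>t\<in>Zd d. \<Sum>u\<in>Zd d. \<Sum>s\<in>Zd d. f t * cnj (h u) * (Zd_char d s u * cnj (Zd_char d s t)))"
    by (intro sum.cong refl sum.swap)
  also have "\<dots> = (\<Sum>t\<in>Zd d. \<Sum>u\<in>Zd d. f t * cnj (h u) * (if t = u then of_nat (card (Zd d)) else 0))"
    by (intro sum.cong refl) (simp add: sum_distrib_left[symmetric] Zd_char_orthogonal[OF d])
  also have "\<dots> = (\<Sum>t\<in>Zd d. \<Sum>u\<in>Zd d. if t = u then f t * cnj (h t) * of_nat (card (Zd d)) else 0)"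
    by (intro sum.cong refl) simp
  also have "\<dots> = (\<Sum>t\<in>Zd d. f t * cnj (h t) * of_nat (card (Zd d)))"
    by (simp add: finite_Zd)
  also have "\<dots> = of_nat (card (Zd d)) * l2_inner (Zd d) f h"
    by (simp add: l2_inner_def sum_distrib_left mult_ac)
  finally show ?thesis .
qed

section \<open>The Weyl operators in coordinates\<close>

text \<open>Indexing by all of the integer lattice gives an additive family, so negative powers and
  products of the \<open>X_op d i\<close> are members of the same family. \<open>char_op\<close>
  does the same for the \<open>Z_op d i\<close>.\<close>

definition shift_op :: "('n \<Rightarrow> nat) \<Rightarrow> int ^ 'n \<Rightarrow> (int ^ 'n \<Rightarrow> complex) \<Rightarrow> int ^ 'n \<Rightarrow> complex" where
  "shift_op d a v = (\<lambda>t. if t \<in> Zd d then v (residue_vec d (t - a)) else 0)"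

definition char_op :: "('n::finite \<Rightarrow> nat) \<Rightarrow> int ^ 'n \<Rightarrow> (int ^ 'n \<Rightarrow> complex) \<Rightarrow> int ^ 'n \<Rightarrow> complex" where
  "char_op d s v = (\<lambda>t. if t \<in> Zd d then Zd_char d s t * v t else 0)"

lemma shift_op_in_l2: "shift_op d a v \<in> l2 (Zd d)"
  by (simp add: shift_op_def l2_def)

lemma char_op_in_l2: "char_op d s v \<in> l2 (Zd d)"
  by (simp add: char_op_def l2_def)

lemma shift_op_add:
  assumes "\<forall>i. 0 < d i"
  shows "shift_op d (a + b) v = shift_op d a (shift_op d b v)"
  by (auto simp: shift_op_def residue_vec_in_Zd[OF assms] residue_vec_diff_left diff_diff_eq)

lemma shift_op_zero: "v \<in> l2 (Zd d) \<Longrightarrow> shift_op d 0 v = v"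
  by (auto simp: shift_op_def l2_def residue_vec_id)

lemma char_op_add: "char_op d (a + b) v = char_op d a (char_op d b v)"
  by (auto simp: char_op_def Zd_char_add_left)

lemma char_op_zero: "v \<in> l2 (Zd d) \<Longrightarrow> char_op d 0 v = v"
  by (auto simp: char_op_def l2_def Zd_char_zero)

lemma X_op_eq_shift_op:
  assumes d: "\<forall>i. 0 < d i"
  shows "X_op d i c = shift_op d (axis i 1) c"
proof
  fix t
  \<comment> \<open>Only one \<open>r\<close> contributes to the entry at \<open>t\<close>, namely
    \<open>t\<close> shifted back; this collapses the sum in \<open>X_op\<close>.\<close>
  have eq: "residue_vec d (r + axis i 1) = t \<longleftrightarrow> t \<in> Zd d \<and> r = residue_vec d (t - axis i 1)"
    if "r \<in> Zd d" for r
    using that residue_vec_in_Zd[OF d]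
    by (auto simp: residue_vec_diff_left residue_vec_add_left residue_vec_id)
  have "X_op d i c t = (\<Sum>r\<in>Zd d. if t \<in> Zd d \<and> r = residue_vec d (t - axis i 1) then c r else 0)"
    unfolding X_op_def basis_vec_def by (rule sum.cong) (auto simp: eq[symmetric])
  also have "\<dots> = shift_op d (axis i 1) c t"
    by (auto simp: shift_op_def finite_Zd residue_vec_in_Zd[OF d])
  finally show "X_op d i c t = shift_op d (axis i 1) c t" .
qed

lemma Z_op_eq_char_op: "Z_op d i c = char_op d (axis i 1) c"
proof
  fix t
  have ax: "(\<Sum>j\<in>UNIV. real_of_int (axis i 1 $ j) * real_of_int (t $ j) / real (d j))
      = (\<Sum>j\<in>UNIV. if j = i then real_of_int (t $ i) / real (d i) else 0)"
    by (rule sum.cong) (auto simp: axis_def)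
  have "Z_op d i c t
      = (\<Sum>r\<in>Zd d. if r = t then c t * cis (2 * pi * real_of_int (t $ i) / real (d i)) else 0)"
    unfolding Z_op_def basis_vec_def by (rule sum.cong) auto
  also have "\<dots> = char_op d (axis i 1) c t"
    using ax by (simp add: char_op_def finite_Zd Zd_char_def mult.commute)
  finally show "Z_op d i c t = char_op d (axis i 1) c t" .
qed

text \<open>Negative powers are taken with \<open>inv_into V F\<close>, so the law can only hold on \<open>V\<close>.\<close>

lemma op_powi_eq_additive_family:
  assumes F: "\<And>v. v \<in> V \<Longrightarrow> F v = G (1::int) v"
    and closed: "\<And>k v. v \<in> V \<Longrightarrow> G k v \<in> V"
    and add: "\<And>j k v. v \<in> V \<Longrightarrow> G (j + k) v = G j (G k v)"
    and zero: "\<And>v. v \<in> V \<Longrightarrow> G 0 v = v"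
    and v: "v \<in> V"
  shows "op_powi V F k v = G k v"
proof -
  \<comment> \<open>Covers both signs of the exponent: \<open>H\<close> is \<open>F\<close> with
    \<open>e = 1\<close>, or its inverse on \<open>V\<close> with \<open>e = - 1\<close>.\<close>
  have pow: "(H ^^ m) v = G (int m * e) v" if H: "\<And>v. v \<in> V \<Longrightarrow> H v = G e v" for H e m
    by (induction m) (simp_all add: zero v H closed add distrib_right)
  have inv: "inv_into V F u = G (- 1) u" if u: "u \<in> V" for u
  proof (rule inv_into_f_eq)
    have "G (- 1) (F u) = u" if "u \<in> V" for u
      using add[OF that, of "- 1" 1] that by (simp add: F zero)
    thus "inj_on F V" by (rule inj_on_inverseI)
    show "G (- 1) u \<in> V" using u by (rule closed)
    show "F (G (- 1) u) = u" using add[OF u, of 1 "- 1"] u by (simp add: F closed zero)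
  qed
  show ?thesis
    using pow[of F 1, OF F] pow[of "inv_into V F" "- 1", OF inv] by (simp add: op_powi_def)
qed

text \<open>Composition becomes addition of indices, and the one-coordinate vectors
  \<open>axis i (r $ i)\<close> add up to \<open>r\<close>.\<close>

lemma ordered_op_prod_eq_additive_family:
  fixes r :: "int ^ ('n::{finite,linorder})"
  assumes F: "\<And>i v. v \<in> V \<Longrightarrow> F i v = G (axis i (r $ i)) v"
    and closed: "\<And>a v. v \<in> V \<Longrightarrow> G a v \<in> V"
    and add: "\<And>a b v. v \<in> V \<Longrightarrow> G (a + b) v = G a (G b v)"
    and zero: "\<And>v. v \<in> V \<Longrightarrow> G 0 v = v"
    and v: "v \<in> V"
  shows "ordered_op_prod F v = G r v"
proof -
  \<comment> \<open>Stated for an arbitrary list, so that induction applies before specialising to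
    the sorted list of all coordinates.\<close>
  have "foldr (\<lambda>i G. F i \<circ> G) xs id v = G (\<Sum>i\<leftarrow>xs. axis i (r $ i)) v" for xs
    by (induction xs) (simp_all add: zero v F closed add)
  moreover have "(\<Sum>i\<leftarrow>sorted_list_of_set UNIV. axis i (r $ i)) = (\<Sum>i\<in>UNIV. axis i (r $ i))"
    by (simp add: sum_list_distinct_conv_sum_set)
  moreover have "(\<Sum>i\<in>UNIV. axis i (r $ i)) = r"
    by (simp add: vec_eq_iff axis_def)
  ultimately show ?thesis by (simp add: ordered_op_prod_def)
qed

lemma op_powi_X_op:
  assumes d: "\<forall>i. 0 < d i" and v: "v \<in> l2 (Zd d)"
  shows "op_powi (l2 (Zd d)) (X_op d i) k v = shift_op d (axis i k) v"
proof (rule op_powi_eq_additive_family[where G = "\<lambda>k. shift_op d (axis i k)", OF _ _ _ _ v])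
  have axis: "axis i (j + k) = axis i j + axis i k" for j k :: int
    by (simp add: vec_eq_iff axis_def)
  show "shift_op d (axis i (j + k)) u = shift_op d (axis i j) (shift_op d (axis i k) u)" for j k u
    by (simp add: axis shift_op_add[OF d])
qed (simp_all add: X_op_eq_shift_op[OF d] shift_op_in_l2 shift_op_zero axis_eq_0_iff[THEN iffD2])

lemma op_powi_Z_op:
  assumes v: "v \<in> l2 (Zd d)"
  shows "op_powi (l2 (Zd d)) (Z_op d i) k v = char_op d (axis i k) v"
proof (rule op_powi_eq_additive_family[where G = "\<lambda>k. char_op d (axis i k)", OF _ _ _ _ v])
  have axis: "axis i (j + k) = axis i j + axis i k" for j k :: int
    by (simp add: vec_eq_iff axis_def)
  show "char_op d (axis i (j + k)) u = char_op d (axis i j) (char_op d (axis i k) u)" for j k u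
    by (simp add: axis char_op_add)
qed (simp_all add: Z_op_eq_char_op char_op_in_l2 char_op_zero axis_eq_0_iff[THEN iffD2])

lemma weyl_op_eq:
  fixes d :: "'n::{finite,linorder} \<Rightarrow> nat"
  assumes d: "\<forall>i. 0 < d i" and v: "v \<in> l2 (Zd d)"
  shows "weyl_op d (r, s) v t =
    cis (pi * (\<Sum>i\<in>UNIV. real_of_int (r $ i) * real_of_int (s $ i) / real (d i))) *
    shift_op d r (char_op d s v) t"
proof -
  have "ordered_op_prod (\<lambda>i. op_powi (l2 (Zd d)) (Z_op d i) (s $ i)) v = char_op d s v"
    by (rule ordered_op_prod_eq_additive_family[where V = "l2 (Zd d)"])
       (simp_all add: op_powi_Z_op char_op_in_l2 char_op_add char_op_zero v)
  moreover have "ordered_op_prod (\<lambda>i. op_powi (l2 (Zd d)) (X_op d i) (r $ i)) u = shift_op d r u"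
    if "u \<in> l2 (Zd d)" for u
    by (rule ordered_op_prod_eq_additive_family[where V = "l2 (Zd d)"])
       (simp_all add: op_powi_X_op[OF d] shift_op_in_l2 shift_op_add[OF d] shift_op_zero that)
  ultimately show ?thesis by (simp add: weyl_op_def char_op_in_l2)
qed

text \<open>The shifted character at \<open>t - r\<close> splits into its value at \<open>t\<close>
  and a constant, which joins the Weyl phase in \<open>z\<close>. Since \<open>z\<close> does not
  depend on \<open>c\<close>, it cancels when one coefficient is multiplied by the conjugate of
  another.\<close>

lemma l2_inner_weyl_op:
  fixes d :: "'n::{finite,linorder} \<Rightarrow> nat"
  assumes d: "\<forall>i. 0 < d i" and v: "v \<in> l2 (Zd d)"
  obtains z where "cmod z = 1"
    and "\<And>c. l2_inner (Zd d) c (weyl_op d (r, s) v) =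
      z * l2_inner (Zd d) (\<lambda>t. c t * cnj (v (residue_vec d (t - r)))) (Zd_char d s)"
proof
  define y where "y = cis (pi * (\<Sum>i\<in>UNIV. real_of_int (r $ i) * real_of_int (s $ i) / real (d i)))"
  show "cmod (cnj y * Zd_char d s r) = 1" by (simp add: norm_mult cmod_Zd_char y_def)
  fix c
  have "weyl_op d (r, s) v t = y * cnj (Zd_char d s r) * (Zd_char d s t * v (residue_vec d (t - r)))"
    if "t \<in> Zd d" for t
    using that residue_vec_in_Zd[OF d]
    by (simp add: weyl_op_eq[OF d v] y_def[symmetric] shift_op_def char_op_def
        Zd_char_residue_right[OF d] Zd_char_diff_right)
  thus "l2_inner (Zd d) c (weyl_op d (r, s) v) =
      cnj y * Zd_char d s r * l2_inner (Zd d) (\<lambda>t. c t * cnj (v (residue_vec d (t - r)))) (Zd_char d s)"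
    by (simp add: l2_inner_def sum_distrib_left mult_ac)
qed

section \<open>The orthogonality relations of the Weyl system\<close>

text \<open>Multiplying coordinate \<open>i\<close> by \<open>sqrt (d i)\<close> turns membership in
  the lattice into divisibility of \<open>r $ i - s $ i\<close> by \<open>d i\<close>.\<close>

lemma inv_sqrt_diag_diff_in_lattice_iff:
  assumes d: "\<forall>i. 0 < d i"
  shows "inv_sqrt_diag d r - inv_sqrt_diag d s \<in> range (sqrt_diag d)
    \<longleftrightarrow> residue_vec d r = residue_vec d s"
proof -
  have comp: "real_of_int a / sqrt (real (d i)) - real_of_int b / sqrt (real (d i))
      = sqrt (real (d i)) * real_of_int k \<longleftrightarrow> a - b = int (d i) * k" for a b k i
  proof -
    have pos: "0 < sqrt (real (d i))" using d by simp
    have "real_of_int a / sqrt (real (d i)) - real_of_int b / sqrt (real (d i))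
      = sqrt (real (d i)) * real_of_int k \<longleftrightarrow>
      real_of_int a - real_of_int b = (sqrt (real (d i)) * sqrt (real (d i))) * real_of_int k"
      using pos by (simp only: diff_divide_distrib[symmetric] divide_eq_eq) (auto simp: mult_ac)
    also have "\<dots> \<longleftrightarrow> real_of_int (a - b) = real_of_int (int (d i) * k)" by simp
    finally show ?thesis by (simp only: of_int_eq_iff)
  qed
  have "inv_sqrt_diag d r - inv_sqrt_diag d s \<in> range (sqrt_diag d)
      \<longleftrightarrow> (\<exists>k. \<forall>i. r $ i - s $ i = int (d i) * k $ i)"
    by (auto simp: image_iff vec_eq_iff inv_sqrt_diag_def sqrt_diag_def comp)
  also have "\<dots> \<longleftrightarrow> (\<forall>i. \<exists>k. r $ i - s $ i = int (d i) * k)"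
    by (metis vec_lambda_beta)
  finally show ?thesis by (simp add: residue_vec_eq_iff dvd_def)
qed

text \<open>Cosets correspond to fibres of the reduction modulo \<open>d\<close>, so any admissible
  choice of representatives labels them by pairs of residues, each pair once.\<close>

lemma bij_betw_KD:
  assumes d: "\<forall>i. 0 < d i" and reps: "integer_reps d rep"
  shows "bij_betw (\<lambda>q. (residue_vec d (fst (rep q)), residue_vec d (snd (rep q)))) (KD d) (Zd d \<times> Zd d)"
proof -
  define E where "E = {(z, w). z \<in> Lambda_adj d \<and> w \<in> Lambda_adj d \<and> z - w \<in> Lambda d}"
  define \<iota> where "\<iota> = (\<lambda>(r, s). (inv_sqrt_diag d r, inv_sqrt_diag d s))"
  define res where "res = (\<lambda>(r, s). (residue_vec d r, residue_vec d s))"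
  have KD: "KD d = Lambda_adj d // E" by (simp add: KD_def E_def)
  have adj: "Lambda_adj d = range \<iota>" by (auto simp: Lambda_adj_def \<iota>_def)
  have E_iff: "(\<iota> p, \<iota> p') \<in> E \<longleftrightarrow> res p = res p'" for p p'
    using inv_sqrt_diag_diff_in_lattice_iff[OF d]
    by (auto simp: E_def adj Lambda_def res_def \<iota>_def split: prod.splits)
  have E_sub: "E \<subseteq> range \<iota> \<times> range \<iota>" by (auto simp: E_def adj)
  have E_img: "E `` {\<iota> p} = \<iota> ` {p'. res p' = res p}" for p
  proof
    show "E `` {\<iota> p} \<subseteq> \<iota> ` {p'. res p' = res p}"
    proof
      fix z assume "z \<in> E `` {\<iota> p}"
      moreover from this obtain p' where "z = \<iota> p'" using E_sub by blast
      ultimately show "z \<in> \<iota> ` {p'. res p' = res p}" using E_iff[of p p'] by simp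
    qed
    show "\<iota> ` {p'. res p' = res p} \<subseteq> E `` {\<iota> p}"
      by (intro image_subsetI) (simp only: Image_singleton_iff E_iff mem_Collect_eq)
  qed
  have rep: "\<iota> (rep q) \<in> q" if "q \<in> KD d" for q
    using reps that by (auto simp: integer_reps_def \<iota>_def split: prod.splits)
  \<comment> \<open>The coset is recovered from the residues of its representative, which gives
    injectivity.\<close>
  have cls: "q = \<iota> ` {p'. res p' = res (rep q)}" if q: "q \<in> KD d" for q
  proof -
    obtain p where p: "q = E `` {\<iota> p}" using q by (auto simp: KD adj quotient_def)
    hence "(\<iota> p, \<iota> (rep q)) \<in> E" using rep[OF q] by simp
    thus ?thesis using p E_img E_iff by simp
  qed
  have res_Zd: "res p \<in> Zd d \<times> Zd d" for p
    by (simp add: res_def residue_vec_in_Zd[OF d] split: prod.splits)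
  have "bij_betw (\<lambda>q. res (rep q)) (KD d) (Zd d \<times> Zd d)"
    unfolding bij_betw_def
  proof
    show "inj_on (\<lambda>q. res (rep q)) (KD d)"
      by (rule inj_onI) (metis cls)
    show "(\<lambda>q. res (rep q)) ` KD d = Zd d \<times> Zd d"
    proof
      show "Zd d \<times> Zd d \<subseteq> (\<lambda>q. res (rep q)) ` KD d"
      proof
        fix p assume p: "p \<in> Zd d \<times> Zd d"
        let ?q = "E `` {\<iota> p}"
        have q: "?q \<in> KD d" unfolding KD adj by (rule quotientI) simp
        have "res (rep ?q) = res p" using rep[OF q] E_iff by simp
        also have "\<dots> = p" using p by (auto simp: res_def residue_vec_id)
        finally show "p \<in> (\<lambda>q. res (rep q)) ` KD d" using q by force
      qed
    qed (use res_Zd in blast)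
  qed
  thus ?thesis by (simp add: res_def case_prod_unfold)
qed

text \<open>Stated in polarised form, with two vectors \<open>a\<close> and \<open>c\<close>, since
  the isometry is needed for inner products and not only for norms.\<close>

lemma weyl_orthogonality:
  fixes d :: "'n::{finite,linorder} \<Rightarrow> nat"
  assumes d: "\<forall>i. 0 < d i" and reps: "integer_reps d rep" and v: "v \<in> l2 (Zd d)"
  shows "(\<Sum>q\<in>KD d. l2_inner (Zd d) a (weyl_op d (rep q) v) * cnj (l2_inner (Zd d) c (weyl_op d (rep q) v)))
    = of_real (real (\<Prod>i\<in>UNIV. d i) * (l2_norm (Zd d) v)\<^sup>2) * l2_inner (Zd d) a c"
proof -
  define tw where "tw = (\<lambda>c r t. c t * cnj (v (residue_vec d (t - r))))"
  define F where "F = (\<lambda>(r, s). l2_inner (Zd d) (tw a r) (Zd_char d s) * cnj (l2_inner (Zd d) (tw c r) (Zd_char d s)))"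
  have "l2_inner (Zd d) a (weyl_op d (r, s) v) * cnj (l2_inner (Zd d) c (weyl_op d (r, s) v))
      = F (residue_vec d r, residue_vec d s)" for r s
  proof -
    obtain z where z: "cmod z = 1" "\<And>c. l2_inner (Zd d) c (weyl_op d (r, s) v) =
      z * l2_inner (Zd d) (tw c r) (Zd_char d s)"
      using l2_inner_weyl_op[OF d v, of r s] unfolding tw_def by blast
    have "z * cnj z = 1" using z(1) by (simp add: complex_norm_square[symmetric])
    hence "l2_inner (Zd d) a (weyl_op d (r, s) v) * cnj (l2_inner (Zd d) c (weyl_op d (r, s) v)) = F (r, s)"
      by (simp add: z(2) F_def mult.left_commute[of "cnj z"] mult.assoc[symmetric])
    \<comment> \<open>With the phase gone, the summand depends on \<open>r\<close> and
      \<open>s\<close> only modulo \<open>d\<close>, so the sum over cosets can be reindexed by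
      pairs of residues.\<close>
    also have "F (r, s) = F (residue_vec d r, residue_vec d s)"
      by (simp add: F_def tw_def residue_vec_diff_right l2_inner_def Zd_char_residue_left[OF d])
    finally show ?thesis .
  qed
  hence "(\<Sum>q\<in>KD d. l2_inner (Zd d) a (weyl_op d (rep q) v) * cnj (l2_inner (Zd d) c (weyl_op d (rep q) v)))
      = (\<Sum>q\<in>KD d. F (residue_vec d (fst (rep q)), residue_vec d (snd (rep q))))"
    by (metis (no_types, lifting) prod.collapse)
  also have "\<dots> = (\<Sum>p\<in>Zd d \<times> Zd d. F p)"
    by (rule sum.reindex_bij_betw[OF bij_betw_KD[OF d reps]])
  also have "\<dots> = (\<Sum>r\<in>Zd d. \<Sum>s\<in>Zd d. F (r, s))"
    by (simp add: sum.cartesian_product)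
  also have "\<dots> = of_nat (card (Zd d)) * (\<Sum>r\<in>Zd d. l2_inner (Zd d) (tw a r) (tw c r))"
    by (simp add: F_def Zd_parseval[OF d] sum_distrib_left)
  also have "(\<Sum>r\<in>Zd d. l2_inner (Zd d) (tw a r) (tw c r)) =
      (\<Sum>t\<in>Zd d. \<Sum>r\<in>Zd d. a t * cnj (c t) * of_real ((cmod (v (residue_vec d (t - r))))\<^sup>2))"
    unfolding l2_inner_def by (subst sum.swap) (simp add: tw_def complex_norm_square mult_ac del: of_real_power)
  also have "\<dots> = (\<Sum>t\<in>Zd d. a t * cnj (c t) * of_real ((l2_norm (Zd d) v)\<^sup>2))"
  proof (rule sum.cong[OF refl])
    fix t
    \<comment> \<open>For fixed \<open>t\<close>, the reflected index runs through every entry of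
      \<open>v\<close> exactly once.\<close>
    have "(\<Sum>r\<in>Zd d. (cmod (v (residue_vec d (t - r))))\<^sup>2) = (l2_norm (Zd d) v)\<^sup>2"
      using sum.reindex_bij_betw[OF bij_betw_Zd_reflect[OF d], of "\<lambda>r. (cmod (v r))\<^sup>2"]
      by (simp add: l2_norm_def sum_nonneg)
    thus "(\<Sum>r\<in>Zd d. a t * cnj (c t) * of_real ((cmod (v (residue_vec d (t - r))))\<^sup>2))
        = a t * cnj (c t) * of_real ((l2_norm (Zd d) v)\<^sup>2)"
      by (metis (no_types, lifting) of_real_sum sum.cong sum_distrib_left)
  qed
  also have "of_nat (card (Zd d)) * \<dots> = of_real (real (\<Prod>i\<in>UNIV. d i) * (l2_norm (Zd d) v)\<^sup>2) * l2_inner (Zd d) a c"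
    by (simp add: card_Zd l2_inner_def sum_distrib_left mult_ac)
  finally show ?thesis .
qed

section \<open>The normalised coefficient map and its projection\<close>

text \<open>The normalising constant is real, so it passes unchanged into the conjugate-linear
  slot.\<close>

lemma B0_eq_analysis_op:
  "B0 d rep v = analysis_op (Zd d) (KD d)
    (\<lambda>q t. of_real (1 / (sqrt (real (\<Prod>i\<in>UNIV. d i)) * l2_norm (Zd d) v)) * weyl_op d (rep q) v t)"
  by (intro ext) (simp add: B0_def analysis_op_def l2_inner_def sum_divide_distrib mult_ac)

lemma B0_isometry:
  fixes d :: "'n::{finite,linorder} \<Rightarrow> nat"
  assumes d: "\<forall>i. 0 < d i" and reps: "integer_reps d rep"
    and v: "v \<in> l2 (Zd d)" "v \<noteq> (\<lambda>r. 0)"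
  shows "l2_inner (KD d) (B0 d rep v a) (B0 d rep v c) = l2_inner (Zd d) a c"
proof -
  let ?N = "real (\<Prod>i\<in>UNIV. d i)" and ?n = "l2_norm (Zd d) v"
  define k where "k = 1 / (sqrt ?N * ?n)"
  have "0 < ?N" using d by (simp only: of_nat_0_less_iff) (simp add: prod_pos)
  moreover have "?n \<noteq> 0" using l2_norm_eq_0_iff[OF finite_Zd v(1)] v(2) by simp
  \<comment> \<open>The prefactor occurs once in each argument; its square cancels the constant of
    the orthogonality relation, both factors being nonzero.\<close>
  ultimately have k: "k * k * (?N * ?n\<^sup>2) = 1"
    by (simp add: k_def power2_eq_square divide_simps del: of_nat_prod)
  have "l2_inner (KD d) (B0 d rep v a) (B0 d rep v c) = of_real (k * k) *
    (\<Sum>q\<in>KD d. l2_inner (Zd d) a (weyl_op d (rep q) v) * cnj (l2_inner (Zd d) c (weyl_op d (rep q) v)))"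
    unfolding l2_inner_def[of "KD d"] B0_def k_def[symmetric]
    by (simp add: sum_distrib_left mult_ac)
  also have "\<dots> = of_real (k * k * (?N * ?n\<^sup>2)) * l2_inner (Zd d) a c"
    by (simp only: weyl_orthogonality[OF d reps v(1)] of_real_mult mult.assoc)
  finally show ?thesis by (simp only: k of_real_1 mult_1_left)
qed

theorem proposition5p6:
  fixes d :: "'n::{finite,linorder} \<Rightarrow> nat"
    and \<phi> :: "real ^ ('n::{finite,linorder}) \<Rightarrow> complex"
    and g :: "'m::finite \<Rightarrow> real ^ ('n::{finite,linorder}) \<Rightarrow> complex"
    and \<alpha> :: "complex ^ 'm"
    and rep :: "((real ^ ('n::{finite,linorder})) \<times> (real ^ ('n::{finite,linorder}))) set \<Rightarrow> (int ^ ('n::{finite,linorder})) \<times> (int ^ ('n::{finite,linorder}))"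
  assumes d_pos: "\<forall>i. 0 < d i"
    and d_dvd: "\<forall>i j. i \<le> j \<longrightarrow> d i dvd d j"
    and window: "schwartz \<phi>" "\<phi> \<noteq> (\<lambda>t. 0)"
    and reps: "integer_reps d rep"
    and g_M1: "\<forall>j. g j \<in> feichtinger \<phi>"
    and g_frame: "generates_gabor_frame d g"
    and v_nonzero: "v_alpha d g \<alpha> \<noteq> (\<lambda>r. 0)"
  shows "let B = B0 d rep (v_alpha d g \<alpha>);
             B_adj = l2_adjoint (Zd d) (KD d) B;
             R = B ` l2 (Zd d);
             P = B \<circ> B_adj
         in orthogonal_projection_onto (KD d) P R \<and>
            (\<forall>b\<in>l2 (KD d).
               (\<forall>a. is_arg_min (\<lambda>a. l2_norm (KD d) (\<lambda>q. b q - a q)) (\<lambda>a. a \<in> R) a \<longleftrightarrow> a = P b) \<and>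
               B_adj b \<in> l2 (Zd d) \<and>
               P b = B (B_adj b) \<and>
               (\<forall>c\<in>l2 (Zd d). B c = P b \<longrightarrow> c = B_adj b))"
proof -
  define v where "v = v_alpha d g \<alpha>"
  define w where "w = (\<lambda>q t. complex_of_real (1 / (sqrt (real (\<Prod>i\<in>UNIV. d i)) * l2_norm (Zd d) v))
    * weyl_op d (rep q) v t)"
  have v: "v \<in> l2 (Zd d)" by (simp add: v_def v_alpha_def vector_zak_def l2_def)
  have B: "B0 d rep v = analysis_op (Zd d) (KD d) w"
    unfolding w_def by (rule B0_eq_analysis_op)
  have fin: "finite (KD d)"
    using bij_betw_finite[OF bij_betw_KD[OF d_pos reps]] by (simp add: finite_Zd)
  have iso: "l2_inner (KD d) (analysis_op (Zd d) (KD d) w a) (analysis_op (Zd d) (KD d) w c)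
      = l2_inner (Zd d) a c" for a c
    using B0_isometry[OF d_pos reps v, of a c] v_nonzero by (simp add: B v_def[symmetric])
  note proj = isometric_analysis_op_projection[OF finite_Zd fin iso]
  \<comment> \<open>Applying the left inverse to both sides shows that \<open>P b\<close> has only
    one logical vector.\<close>
  have inj: "c = synthesis_op (Zd d) (KD d) w b"
    if "c \<in> l2 (Zd d)"
      and "analysis_op (Zd d) (KD d) w c = analysis_op (Zd d) (KD d) w (synthesis_op (Zd d) (KD d) w b)" for b c
    using proj(1)[OF that(1)] proj(1)[OF synthesis_op_in_l2[where b = b]] that(2) by simp
  show ?thesis
    unfolding Let_def v_def[symmetric] B l2_adjoint_analysis_op[OF finite_Zd] comp_apply
    using proj(2,3) synthesis_op_in_l2 inj by (intro conjI ballI allI impI) (simp_all add: comp_def)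
qed

end
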